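(* Let $G$ be a finite rank additive subgroup of $V=\mathbb{Q}^{\mathbb{N}}$. The group $\operatorname{Aut}(G)$ acts on the set of complete decompositions of $G$, an automorphism $\alpha$ sending $\bigoplus_{i\in[t]}A_i$ to $\bigoplus_{i\in[t]}A_i\alpha$, and the orbits of this action are exactly the isomorphism classes of complete decompositions of $G$; that is, two complete decompositions of $G$ lie in the same orbit if and only if they are isomorphic.
   Context: Automorphisms are written on the right. $[t]=\{1,\dots,t\}$. A group is indecomposable if it is not the direct sum of two non-zero subgroups. A complete decomposition of $G$ is an (internal, unordered) direct decomposition $G=\bigoplus_{i\in[t]}A_i$ in which each $A_i$ is a non-zero indecomposable subgroup of $G$. Two complete decompositions $\bigoplus_{i\in[t]}A_i$ and $\bigoplus_{j\in[s]}C_j$ of $G$ are isomorphic if $t=s$ and there is a permutation $\pi$ of $[t]$ such that $C_{i\pi}\cong A_i$ for all $i\in[t]$. *)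

theory Defs
  imports "HOL-Algebra.Algebra" "HOL-Algebra.Product_Groups"
begin

definition rational_group :: "rat monoid"
  where "rational_group = \<lparr>carrier = UNIV, monoid.mult = (+), one = 0\<rparr>"

text \<open>The additive group of \<open>V = \<rat>\<^sup>\<nat>\<close>: all rational sequences under pointwise addition.
  The group operation is written multiplicatively, as everywhere in HOL-Algebra.\<close>

definition rat_sequences :: "(nat \<Rightarrow> rat) monoid"
  where "rat_sequences = product_group UNIV (\<lambda>_. rational_group)"

abbreviation rat_sequences_on :: "(nat \<Rightarrow> rat) set \<Rightarrow> (nat \<Rightarrow> rat) monoid"
  where "rat_sequences_on G \<equiv> rat_sequences\<lparr>carrier := G\<rparr>"

text \<open>Linear independence over the integers; in additive notation, no nontrivial relation
  \<open>(\<Sum>v\<in>T. c v \<cdot> v) = 0\<close> holds among the elements of \<open>B\<close>.\<close>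

definition int_independent :: "('a, 'm) monoid_scheme \<Rightarrow> 'a set \<Rightarrow> bool"
  where "int_independent G B \<longleftrightarrow> B \<subseteq> carrier G \<and>
    (\<forall>T (c :: 'a \<Rightarrow> int). finite T \<and> T \<subseteq> B \<and> (\<Otimes>\<^bsub>G\<^esub>v\<in>T. v [^]\<^bsub>G\<^esub> c v) = \<one>\<^bsub>G\<^esub>
       \<longrightarrow> (\<forall>v\<in>T. c v = 0))"

text \<open>The rank of a torsion-free abelian group is the cardinality of a maximal independent
  subset (it does not depend on the choice of the subset).\<close>

definition finite_rank :: "('a, 'm) monoid_scheme \<Rightarrow> bool"
  where "finite_rank G \<longleftrightarrow>
    (\<exists>B. finite B \<and> int_independent G B \<and> (\<forall>B'. int_independent G B' \<and> B \<subseteq> B' \<longrightarrow> B' = B))"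

text \<open>\<open>G = \<Oplus>i\<in>I. A i\<close>, internally and with \<open>I\<close> finite: every element of \<open>G\<close> is, in exactly one
  way, a sum of elements \<open>x i \<in> A i\<close>.\<close>

definition internal_direct_sum :: "('a, 'm) monoid_scheme \<Rightarrow> 'i set \<Rightarrow> ('i \<Rightarrow> 'a set) \<Rightarrow> bool"
  where "internal_direct_sum G I A \<longleftrightarrow> finite I \<and> (\<forall>i\<in>I. subgroup (A i) G) \<and>
    bij_betw (\<lambda>x. \<Otimes>\<^bsub>G\<^esub>i\<in>I. x i) (PiE I A) (carrier G)"

definition indecomposable_group :: "('a, 'm) monoid_scheme \<Rightarrow> bool"
  where "indecomposable_group G \<longleftrightarrow>
    \<not> (\<exists>A. internal_direct_sum G {1..2::nat} A \<and> A 1 \<noteq> {\<one>\<^bsub>G\<^esub>} \<and> A 2 \<noteq> {\<one>\<^bsub>G\<^esub>})"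

text \<open>An unordered decomposition is represented by the set of its summands, which serves as its
  own index set. No repetition is lost: the summands are nonzero and meet trivially in pairs, hence
  are distinct. The zero group has the empty decomposition.\<close>

definition complete_decompositions :: "('a, 'm) monoid_scheme \<Rightarrow> 'a set set set"
  where "complete_decompositions G = {D. internal_direct_sum G D (\<lambda>A. A) \<and>
    (\<forall>A\<in>D. A \<noteq> {\<one>\<^bsub>G\<^esub>} \<and> indecomposable_group (G\<lparr>carrier := A\<rparr>))}"

text \<open>For decompositions \<open>D = {A 1, \<dots>, A t}\<close> and \<open>E = {C 1, \<dots>, C s}\<close>, a bijection from \<open>D\<close> to
  \<open>E\<close> amounts to \<open>t = s\<close> together with a permutation of the indices.\<close>

definition isomorphic_decompositions ::
    "('a, 'm) monoid_scheme \<Rightarrow> 'a set set \<Rightarrow> 'a set set \<Rightarrow> bool"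
  where "isomorphic_decompositions G D E \<longleftrightarrow>
    (\<exists>\<pi>. bij_betw \<pi> D E \<and> (\<forall>A\<in>D. G\<lparr>carrier := \<pi> A\<rparr> \<cong> G\<lparr>carrier := A\<rparr>))"

definition decomposition_iso_rel :: "('a, 'm) monoid_scheme \<Rightarrow> ('a set set \<times> 'a set set) set"
  where "decomposition_iso_rel G = {(D, E). D \<in> complete_decompositions G \<and>
    E \<in> complete_decompositions G \<and> isomorphic_decompositions G D E}"

text \<open>The multiplication of \<^const>\<open>AutoGroup\<close> is composition of functions written on the left,
  so the right action \<open>A \<mapsto> A\<alpha>\<close> (automorphisms written on the right and multiplied accordingly)
  becomes a left action of \<^const>\<open>AutoGroup\<close>. The restriction to complete decompositions is
  needed because \<^const>\<open>BijGroup\<close> consists of extensional functions.\<close>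

definition decomposition_action ::
    "('a, 'm) monoid_scheme \<Rightarrow> ('a \<Rightarrow> 'a) \<Rightarrow> 'a set set \<Rightarrow> 'a set set"
  where "decomposition_action G \<alpha> = (\<lambda>D\<in>complete_decompositions G. (\<lambda>A. \<alpha> ` A) ` D)"

end

theory Submission
  imports Defs
begin

text \<open>
  Both directions of the orbit criterion rest on transporting direct sums. An automorphism
  \<open>\<alpha>\<close> of an abelian group carries a complete decomposition \<open>D\<close> to a complete decomposition,
  because being a direct sum (\<open>internal_direct_sum_iso_image\<close>) and being indecomposable
  (\<open>indecomposable_group_iso\<close>) are isomorphism invariants; and it maps each summand \<open>A\<close>
  isomorphically onto \<open>\<alpha> ` A\<close>, so \<open>D\<close> and its image are isomorphic decompositions.
  Conversely, isomorphisms between the summands of \<open>D\<close> and those of \<open>E\<close> that they are matched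
  with add up to one isomorphism of the direct sums (\<open>internal_direct_sum_iso_extension\<close>). As
  both sums are all of \<open>G\<close>, this is an automorphism, and it takes \<open>D\<close> to \<open>E\<close>.
  The orbits are therefore the classes of the isomorphism relation.
\<close>

section \<open>Direct sums and isomorphisms\<close>

lemma comm_group_subgroup:
  assumes "comm_group G" and "subgroup A G"
  shows "comm_group (G\<lparr>carrier := A\<rparr>)"
proof -
  interpret comm_group G by fact
  interpret A: subgroup A G by fact
  have "group (G\<lparr>carrier := A\<rparr>)" by (rule subgroup_imp_group[OF assms(2)])
  then show ?thesis
    by (rule group.group_comm_groupI) (simp add: m_comm)
qed

lemma hom_finprod_comm_group:
  assumes "comm_group G" and "comm_group H" and "h \<in> hom G H" and "f \<in> I \<rightarrow> carrier G"
  shows "h (finprod G f I) = finprod H (\<lambda>i. h (f i)) I"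
proof -
  interpret G: comm_group G by fact
  interpret H: comm_group H by fact
  interpret group_hom G H h
    by (simp add: group_hom_def group_hom_axioms_def G.is_group H.is_group assms(3))
  show ?thesis
    using assms(4)
  proof (induction I rule: infinite_finite_induct)
    case (insert i I)
    then show ?case by (simp add: Pi_iff)
  qed simp_all
qed

lemma bij_betw_PiE_map:
  assumes "\<And>i. i \<in> I \<Longrightarrow> bij_betw (f i) (A i) (B i)"
  shows "bij_betw (\<lambda>x. \<lambda>i\<in>I. f i (x i)) (PiE I A) (PiE I B)"
proof (rule bij_betw_byWitness[where f' = "\<lambda>y. \<lambda>i\<in>I. inv_into (A i) (f i) (y i)"])
  show "\<forall>x\<in>PiE I A. (\<lambda>i\<in>I. inv_into (A i) (f i) ((\<lambda>i\<in>I. f i (x i)) i)) = x"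
    using assms by (auto intro!: extensionalityI[where A = I] simp: PiE_iff
        bij_betw_inv_into_left[OF assms])
  show "\<forall>y\<in>PiE I B. (\<lambda>i\<in>I. f i ((\<lambda>i\<in>I. inv_into (A i) (f i) (y i)) i)) = y"
    using assms by (auto intro!: extensionalityI[where A = I] simp: PiE_iff
        bij_betw_inv_into_right[OF assms])
  show "(\<lambda>x. \<lambda>i\<in>I. f i (x i)) ` PiE I A \<subseteq> PiE I B"
    using assms by (force simp: PiE_iff bij_betw_def)
  show "(\<lambda>y. \<lambda>i\<in>I. inv_into (A i) (f i) (y i)) ` PiE I B \<subseteq> PiE I A"
    using assms by (auto simp: PiE_iff bij_betw_def inv_into_into)
qed

lemma internal_direct_sum_carrier:
  assumes "internal_direct_sum G I A" and "x \<in> PiE I A" and "i \<in> I"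
  shows "x i \<in> A i" and "x i \<in> carrier G"
  using assms unfolding internal_direct_sum_def
  by (auto simp: PiE_iff dest!: bspec subgroup.subset)

text \<open>Because \<open>h\<close> commutes with finite sums, summing in \<open>H\<close> after applying \<open>h\<close> to each
  component is \<open>h\<close> after summing in \<open>G\<close>. The latter is a bijection, and so is the componentwise
  map, hence so is summation over the images.\<close>

lemma internal_direct_sum_iso_image:
  assumes "comm_group G" and "comm_group H" and h: "h \<in> iso G H"
    and sum: "internal_direct_sum G I A"
  shows "internal_direct_sum H I (\<lambda>i. h ` A i)"
proof -
  interpret G: comm_group G by fact
  interpret H: comm_group H by fact
  have hom: "h \<in> hom G H" and bij: "bij_betw h (carrier G) (carrier H)"
    using h by (auto simp: iso_def)
  interpret group_hom G H h
    by (simp add: group_hom_def group_hom_axioms_def G.is_group H.is_group hom)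
  let ?T = "\<lambda>x. \<lambda>i\<in>I. h (x i)"
  have sub: "subgroup (A i) G" if "i \<in> I" for i
    using sum that by (simp add: internal_direct_sum_def)
  have T: "bij_betw ?T (PiE I A) (PiE I (\<lambda>i. h ` A i))"
  proof (rule bij_betw_PiE_map)
    fix i assume "i \<in> I"
    then show "bij_betw h (A i) (h ` A i)"
      using bij sub subgroup.subset by (meson bij_betw_def inj_on_imp_bij_betw inj_on_subset)
  qed
  have "bij_betw (h \<circ> (\<lambda>x. \<Otimes>\<^bsub>G\<^esub>i\<in>I. x i)) (PiE I A) (carrier H)"
    using sum bij by (auto simp: internal_direct_sum_def intro: bij_betw_trans)
  moreover have "h (\<Otimes>\<^bsub>G\<^esub>i\<in>I. x i) = (\<Otimes>\<^bsub>H\<^esub>i\<in>I. ?T x i)" if "x \<in> PiE I A" for x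
  proof -
    have x: "x \<in> I \<rightarrow> carrier G"
      using internal_direct_sum_carrier[OF sum that] by auto
    have "(\<Otimes>\<^bsub>H\<^esub>i\<in>I. ?T x i) = (\<Otimes>\<^bsub>H\<^esub>i\<in>I. h (x i))"
      using x by (intro H.finprod_cong') (auto simp: Pi_iff)
    then show ?thesis
      using hom_finprod_comm_group[OF assms(1,2) hom x] by simp
  qed
  ultimately have "bij_betw ((\<lambda>y. \<Otimes>\<^bsub>H\<^esub>i\<in>I. y i) \<circ> ?T) (PiE I A) (carrier H)"
    by (elim bij_betw_cong[THEN iffD1, rotated]) (simp only: o_apply)
  then have "bij_betw (\<lambda>y. \<Otimes>\<^bsub>H\<^esub>i\<in>I. y i) (PiE I (\<lambda>i. h ` A i)) (carrier H)"
    using bij_betw_comp_iff[OF T] by blast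
  then show ?thesis
    using sum sub by (simp add: internal_direct_sum_def subgroup_img_is_subgroup)
qed

text \<open>An unordered decomposition is indexed by its own summands, so the image of a decomposition
  under a map has to be re-indexed by the images.\<close>

lemma internal_direct_sum_reindex:
  assumes "comm_group G" and p: "inj_on p I"
    and sum: "internal_direct_sum G I (\<lambda>i. A (p i))"
  shows "internal_direct_sum G (p ` I) A"
proof -
  interpret comm_group G by fact
  have sub: "subgroup (A (p i)) G" if "i \<in> I" for i
    using sum that by (simp add: internal_direct_sum_def)
  let ?R = "\<lambda>y. \<lambda>i\<in>I. y (p i)"
  have R: "bij_betw ?R (PiE (p ` I) A) (PiE I (\<lambda>i. A (p i)))"
  proof (rule bij_betw_byWitness[where f' = "\<lambda>x. \<lambda>j\<in>p ` I. x (inv_into I p j)"])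
    show "\<forall>y\<in>PiE (p ` I) A. (\<lambda>j\<in>p ` I. ?R y (inv_into I p j)) = y"
      using p by (auto intro!: PiE_ext[where k = "p ` I" and s = A] simp: PiE_iff)
    show "\<forall>x\<in>PiE I (\<lambda>i. A (p i)). ?R (\<lambda>j\<in>p ` I. x (inv_into I p j)) = x"
      using p by (auto intro!: PiE_ext[where k = I and s = "\<lambda>i. A (p i)"] simp: PiE_iff)
    show "?R ` PiE (p ` I) A \<subseteq> PiE I (\<lambda>i. A (p i))"
      by (auto simp: PiE_iff)
    show "(\<lambda>x. \<lambda>j\<in>p ` I. x (inv_into I p j)) ` PiE I (\<lambda>i. A (p i)) \<subseteq> PiE (p ` I) A"
      using p by (auto simp: PiE_iff)
  qed
  have "bij_betw ((\<lambda>x. \<Otimes>\<^bsub>G\<^esub>i\<in>I. x i) \<circ> ?R) (PiE (p ` I) A) (carrier G)"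
    using sum by (auto simp: internal_direct_sum_def intro: bij_betw_trans[OF R])
  moreover have "(\<Otimes>\<^bsub>G\<^esub>i\<in>I. ?R y i) = (\<Otimes>\<^bsub>G\<^esub>j\<in>p ` I. y j)" if "y \<in> PiE (p ` I) A" for y
  proof -
    have y: "y \<in> p ` I \<rightarrow> carrier G"
      using that sub subgroup.subset by (fastforce simp: PiE_iff)
    have "(\<Otimes>\<^bsub>G\<^esub>i\<in>I. ?R y i) = (\<Otimes>\<^bsub>G\<^esub>i\<in>I. y (p i))"
      using y by (intro finprod_cong') auto
    then show ?thesis
      using finprod_reindex[OF y p] by simp
  qed
  ultimately have "bij_betw (\<lambda>y. \<Otimes>\<^bsub>G\<^esub>j\<in>p ` I. y j) (PiE (p ` I) A) (carrier G)"
    by (elim bij_betw_cong[THEN iffD1, rotated]) (simp only: o_apply)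
  then show ?thesis
    using sum sub by (auto simp: internal_direct_sum_def)
qed

text \<open>The extension sends \<open>\<Sum>i. x i\<close> to \<open>\<Sum>i. f i (x i)\<close>. Uniqueness of the components makes
  it well defined and bijective; commutativity makes it additive, since sums can then be formed
  componentwise.\<close>

lemma internal_direct_sum_iso_extension:
  assumes "comm_group G" and "comm_group H"
    and sumA: "internal_direct_sum G I A" and sumB: "internal_direct_sum H I B"
    and f: "\<And>i. i \<in> I \<Longrightarrow> f i \<in> iso (G\<lparr>carrier := A i\<rparr>) (H\<lparr>carrier := B i\<rparr>)"
  obtains h where "h \<in> iso G H" and "\<And>i a. i \<in> I \<Longrightarrow> a \<in> A i \<Longrightarrow> h a = f i a"
proof -
  interpret G: comm_group G by fact
  interpret H: comm_group H by fact
  have fin: "finite I" using sumA by (simp add: internal_direct_sum_def)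
  have subA: "subgroup (A i) G" and subB: "subgroup (B i) H" if "i \<in> I" for i
    using sumA sumB that by (simp_all add: internal_direct_sum_def)
  have fbij: "bij_betw (f i) (A i) (B i)" if "i \<in> I" for i
    using f[OF that] by (simp add: iso_def)
  have fmult: "f i (a \<otimes>\<^bsub>G\<^esub> b) = f i a \<otimes>\<^bsub>H\<^esub> f i b" if "i \<in> I" "a \<in> A i" "b \<in> A i" for i a b
    using f[OF that(1)] that by (simp add: iso_def hom_def)
  have fone: "f i \<one>\<^bsub>G\<^esub> = \<one>\<^bsub>H\<^esub>" if "i \<in> I" for i
  proof -
    have "f i \<in> hom (G\<lparr>carrier := A i\<rparr>) (H\<lparr>carrier := B i\<rparr>)"
      using f[OF that] by (simp add: iso_def)
    from hom_one[OF this] show ?thesis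
      using subA[OF that] subB[OF that] G.subgroup_imp_group H.subgroup_imp_group by simp
  qed
  let ?P = "\<lambda>x. \<Otimes>\<^bsub>G\<^esub>i\<in>I. x i" and ?Q = "\<lambda>y. \<Otimes>\<^bsub>H\<^esub>i\<in>I. y i"
  let ?T = "\<lambda>x. \<lambda>i\<in>I. f i (x i)"
  have P: "bij_betw ?P (PiE I A) (carrier G)" and Q: "bij_betw ?Q (PiE I B) (carrier H)"
    using sumA sumB by (simp_all add: internal_direct_sum_def)
  have T: "bij_betw ?T (PiE I A) (PiE I B)"
    by (rule bij_betw_PiE_map[OF fbij])
  define h where "h = ?Q \<circ> ?T \<circ> inv_into (PiE I A) ?P"
  have hP: "h (?P x) = ?Q (?T x)" if "x \<in> PiE I A" for x
    using bij_betw_inv_into_left[OF P that] by (simp only: h_def o_apply)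
  have hbij: "bij_betw h (carrier G) (carrier H)"
    unfolding h_def
    by (intro bij_betw_trans[OF bij_betw_inv_into[OF P]] bij_betw_trans[OF T Q])
  have "h (g \<otimes>\<^bsub>G\<^esub> g') = h g \<otimes>\<^bsub>H\<^esub> h g'" if g: "g \<in> carrier G" and g': "g' \<in> carrier G" for g g'
  proof -
    obtain x where x: "x \<in> PiE I A" "g = ?P x"
      using bij_betw_imp_surj_on[OF P] g by blast
    obtain y where y: "y \<in> PiE I A" "g' = ?P y"
      using bij_betw_imp_surj_on[OF P] g' by blast
    let ?xy = "\<lambda>i\<in>I. x i \<otimes>\<^bsub>G\<^esub> y i"
    note xyA = internal_direct_sum_carrier[OF sumA x(1)] internal_direct_sum_carrier[OF sumA y(1)]
    have xy: "?xy \<in> PiE I A"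
      using xyA subA by (auto intro: subgroup.m_closed)
    have Tx: "?T x \<in> PiE I B" "?T y \<in> PiE I B"
      using bij_betw_apply[OF T] x(1) y(1) by blast+
    note TxB = internal_direct_sum_carrier(2)[OF sumB Tx(1)]
      internal_direct_sum_carrier(2)[OF sumB Tx(2)]
    have "g \<otimes>\<^bsub>G\<^esub> g' = (\<Otimes>\<^bsub>G\<^esub>i\<in>I. x i \<otimes>\<^bsub>G\<^esub> y i)"
      using xyA by (subst G.finprod_multf) (auto simp: x y)
    also have "\<dots> = ?P ?xy"
      using xyA by (intro G.finprod_cong') auto
    finally have "h (g \<otimes>\<^bsub>G\<^esub> g') = ?Q (?T ?xy)"
      using hP[OF xy] by simp
    also have "\<dots> = (\<Otimes>\<^bsub>H\<^esub>i\<in>I. ?T x i \<otimes>\<^bsub>H\<^esub> ?T y i)"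
      using xyA TxB by (intro H.finprod_cong') (auto simp: fmult)
    also have "\<dots> = ?Q (?T x) \<otimes>\<^bsub>H\<^esub> ?Q (?T y)"
      using TxB by (intro H.finprod_multf funcsetI)
    finally show ?thesis
      using hP x y by simp
  qed
  then have "h \<in> iso G H"
    using hbij by (auto simp: iso_def hom_def bij_betw_def)
  moreover have "h a = f i a" if i: "i \<in> I" and a: "a \<in> A i" for i a
  proof -
    \<comment> \<open>\<open>a\<close> is the sum of the family concentrated at \<open>i\<close>, and the componentwise map keeps that
      shape because every \<open>f j\<close> preserves the neutral element.\<close>
    let ?d = "\<lambda>j\<in>I. if i = j then a else \<one>\<^bsub>G\<^esub>"
    have aG: "a \<in> carrier G"
      using subgroup.subset[OF subA[OF i]] a by blast
    have faH: "f i a \<in> carrier H"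
      using subgroup.subset[OF subB[OF i]] bij_betw_apply[OF fbij[OF i] a] by blast
    have d: "?d \<in> PiE I A"
      using a subgroup.one_closed[OF subA] by auto
    have "?P ?d = (\<Otimes>\<^bsub>G\<^esub>j\<in>I. if i = j then a else \<one>\<^bsub>G\<^esub>)"
      using aG by (intro G.finprod_cong') auto
    also have "\<dots> = a"
      using G.finprod_singleton[OF i fin, of "\<lambda>_. a"] aG by simp
    finally have "h a = ?Q (?T ?d)"
      using hP[OF d] by simp
    also have "\<dots> = (\<Otimes>\<^bsub>H\<^esub>j\<in>I. if i = j then f i a else \<one>\<^bsub>H\<^esub>)"
      using faH fone by (intro H.finprod_cong') auto
    also have "\<dots> = f i a"
      using H.finprod_singleton[OF i fin, of "\<lambda>_. f i a"] faH by simp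
    finally show ?thesis .
  qed
  ultimately show ?thesis
    using that by blast
qed

text \<open>A nontrivial splitting of \<open>H\<close> would be carried to one of \<open>G\<close> by an isomorphism
  \<open>k\<close> from \<open>H\<close> to \<open>G\<close>.\<close>

lemma indecomposable_group_iso:
  assumes "comm_group G" and "comm_group H" and "G \<cong> H" and indec: "indecomposable_group G"
  shows "indecomposable_group H"
  unfolding indecomposable_group_def
proof (rule notI, elim exE conjE)
  interpret G: comm_group G by fact
  interpret H: comm_group H by fact
  fix A assume sum: "internal_direct_sum H {1..2::nat} A"
    and A: "A 1 \<noteq> {\<one>\<^bsub>H\<^esub>}" "A 2 \<noteq> {\<one>\<^bsub>H\<^esub>}"
  obtain k where k: "k \<in> iso H G"
    using G.iso_sym[OF \<open>G \<cong> H\<close>] by (auto simp: is_iso_def)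
  interpret group_hom H G k
    using k by (simp add: group_hom_def group_hom_axioms_def G.is_group H.is_group iso_def)
  have "k ` A i \<noteq> {\<one>\<^bsub>G\<^esub>}" if i: "i \<in> {1..2}" and "A i \<noteq> {\<one>\<^bsub>H\<^esub>}" for i
  proof -
    have sub: "subgroup (A i) H"
      using sum i by (simp add: internal_direct_sum_def)
    then obtain a where "a \<in> A i" "a \<noteq> \<one>\<^bsub>H\<^esub>"
      using \<open>A i \<noteq> {\<one>\<^bsub>H\<^esub>}\<close> subgroup.one_closed by blast
    moreover from this have "k a \<noteq> \<one>\<^bsub>G\<^esub>"
      using k subgroup.subset[OF sub] iso_iff by blast
    ultimately show ?thesis by blast
  qed
  from this[of 1] this[of 2] have "k ` A 1 \<noteq> {\<one>\<^bsub>G\<^esub>}" "k ` A 2 \<noteq> {\<one>\<^bsub>G\<^esub>}"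
    using A by simp_all
  then show False
    using internal_direct_sum_iso_image[OF assms(2,1) k sum] indec
    unfolding indecomposable_group_def by blast
qed

section \<open>Automorphisms and complete decompositions\<close>

lemma iso_restrict_subgroup:
  assumes "h \<in> iso G H" and "subgroup A G"
  shows "h \<in> iso (G\<lparr>carrier := A\<rparr>) (H\<lparr>carrier := h ` A\<rparr>)"
  using assms subgroup.subset[OF assms(2)]
  by (auto simp: iso_def hom_def bij_betw_def subset_iff intro: inj_on_subset)

lemma complete_decompositions_subgroup:
  assumes "D \<in> complete_decompositions G" and "A \<in> D"
  shows "subgroup A G"
  using assms by (simp add: complete_decompositions_def internal_direct_sum_def)

lemma iso_inj_on_decomposition:
  assumes "h \<in> iso G H" and "D \<in> complete_decompositions G"
  shows "inj_on ((`) h) D"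
proof (rule inj_on_subset)
  show "inj_on ((`) h) (Pow (carrier G))"
    using assms(1) by (intro inj_on_image_Pow) (simp add: iso_iff)
  show "D \<subseteq> Pow (carrier G)"
    using subgroup.subset[OF complete_decompositions_subgroup[OF assms(2)]] by blast
qed

lemma complete_decompositions_iso_image:
  assumes "comm_group G" and "comm_group H" and h: "h \<in> iso G H"
    and D: "D \<in> complete_decompositions G"
  shows "(`) h ` D \<in> complete_decompositions H"
proof -
  interpret G: comm_group G by fact
  interpret H: comm_group H by fact
  interpret group_hom G H h
    using h by (simp add: group_hom_def group_hom_axioms_def G.is_group H.is_group iso_def)
  have "internal_direct_sum G D (\<lambda>A. A)"
    using D by (simp add: complete_decompositions_def)
  then have "internal_direct_sum H D (\<lambda>A. h ` A)"
    by (rule internal_direct_sum_iso_image[OF assms(1,2) h])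
  then have "internal_direct_sum H ((`) h ` D) (\<lambda>A. A)"
    by (rule internal_direct_sum_reindex[OF assms(2) iso_inj_on_decomposition[OF h D]])
  moreover have "h ` A \<noteq> {\<one>\<^bsub>H\<^esub>}" and "indecomposable_group (H\<lparr>carrier := h ` A\<rparr>)"
    if "A \<in> D" for A
  proof -
    have sub: "subgroup A G"
      by (rule complete_decompositions_subgroup[OF D that])
    have A: "A \<noteq> {\<one>\<^bsub>G\<^esub>}" "indecomposable_group (G\<lparr>carrier := A\<rparr>)"
      using D that by (simp_all add: complete_decompositions_def)
    obtain a where "a \<in> A" "a \<noteq> \<one>\<^bsub>G\<^esub>"
      using A(1) subgroup.one_closed[OF sub] by blast
    moreover from this have "h a \<noteq> \<one>\<^bsub>H\<^esub>"
      using h subgroup.subset[OF sub] iso_iff by blast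
    ultimately show "h ` A \<noteq> {\<one>\<^bsub>H\<^esub>}" by blast
    show "indecomposable_group (H\<lparr>carrier := h ` A\<rparr>)"
      using indecomposable_group_iso[OF comm_group_subgroup[OF assms(1) sub]
          comm_group_subgroup[OF assms(2) subgroup_img_is_subgroup[OF sub]]
          is_isoI[OF iso_restrict_subgroup[OF h sub]] A(2)] .
  qed
  ultimately show ?thesis
    by (auto simp: complete_decompositions_def)
qed

lemma carrier_AutoGroup: "carrier (AutoGroup G) = iso G G \<inter> extensional (carrier G)"
  by (auto simp: AutoGroup_def auto_def Bij_def iso_def)

lemma isomorphic_decompositions_iff_automorphism:
  assumes "comm_group G" and D: "D \<in> complete_decompositions G"
    and E: "E \<in> complete_decompositions G"
  shows "isomorphic_decompositions G D E \<longleftrightarrow> (\<exists>\<alpha>\<in>carrier (AutoGroup G). (`) \<alpha> ` D = E)"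
proof
  interpret comm_group G by fact
  assume "isomorphic_decompositions G D E"
  then obtain \<pi> where \<pi>: "bij_betw \<pi> D E"
    and iso: "\<And>A. A \<in> D \<Longrightarrow> G\<lparr>carrier := \<pi> A\<rparr> \<cong> G\<lparr>carrier := A\<rparr>"
    by (auto simp: isomorphic_decompositions_def)
  have \<pi>E: "\<pi> A \<in> E" if "A \<in> D" for A
    using \<pi> that by (rule bij_betw_apply)
  have "G\<lparr>carrier := A\<rparr> \<cong> G\<lparr>carrier := \<pi> A\<rparr>" if "A \<in> D" for A
    using group.iso_sym[OF subgroup_imp_group iso[OF that]]
      complete_decompositions_subgroup[OF E \<pi>E[OF that]] by blast
  then have "\<forall>A\<in>D. \<exists>f. f \<in> iso (G\<lparr>carrier := A\<rparr>) (G\<lparr>carrier := \<pi> A\<rparr>)"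
    by (auto simp: is_iso_def)
  then obtain f where f: "\<And>A. A \<in> D \<Longrightarrow> f A \<in> iso (G\<lparr>carrier := A\<rparr>) (G\<lparr>carrier := \<pi> A\<rparr>)"
    unfolding bchoice_iff by blast
  have sumD: "internal_direct_sum G D (\<lambda>A. A)" and sumE: "internal_direct_sum G E (\<lambda>A. A)"
    using D E by (simp_all add: complete_decompositions_def)
  \<comment> \<open>Both decompositions are needed over the index set \<open>D\<close>, so \<open>E\<close> is re-indexed along the
    inverse of the matching.\<close>
  have "internal_direct_sum G (inv_into D \<pi> ` E) \<pi>"
    using sumE \<pi>
    by (intro internal_direct_sum_reindex[OF assms(1)])
      (auto simp: bij_betw_def inj_on_inv_into internal_direct_sum_def f_inv_into_f cong: PiE_cong)
  then have "internal_direct_sum G D \<pi>"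
    using bij_betw_inv_into[OF \<pi>] by (simp add: bij_betw_def)
  then obtain h where h: "h \<in> iso G G" and hf: "\<And>A a. A \<in> D \<Longrightarrow> a \<in> A \<Longrightarrow> h a = f A a"
    using internal_direct_sum_iso_extension[OF assms(1,1) sumD _ f] by blast
  \<comment> \<open>Elements of the automorphism group are extensional, whence the restriction of \<open>h\<close>.\<close>
  have "restrict h (carrier G) ` A = \<pi> A" if "A \<in> D" for A
  proof -
    have "restrict h (carrier G) ` A = f A ` A"
      using subgroup.subset[OF complete_decompositions_subgroup[OF D that]] hf[OF that]
      by (auto intro!: image_cong)
    also have "\<dots> = \<pi> A"
      using f[OF that] by (simp add: iso_def bij_betw_def)
    finally show ?thesis .
  qed
  then have "(`) (restrict h (carrier G)) ` D = E"
    using \<pi> by (auto simp: bij_betw_def)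
  moreover have "restrict h (carrier G) \<in> carrier (AutoGroup G)"
    using iso_eq[OF h, of "restrict h (carrier G)"] by (simp add: carrier_AutoGroup)
  ultimately show "\<exists>\<alpha>\<in>carrier (AutoGroup G). (`) \<alpha> ` D = E" by blast
next
  interpret comm_group G by fact
  assume "\<exists>\<alpha>\<in>carrier (AutoGroup G). (`) \<alpha> ` D = E"
  then obtain \<alpha> where \<alpha>: "\<alpha> \<in> iso G G" and E': "(`) \<alpha> ` D = E"
    by (auto simp: carrier_AutoGroup)
  have "bij_betw ((`) \<alpha>) D E"
    using iso_inj_on_decomposition[OF \<alpha> D] E' by (simp add: bij_betw_def)
  moreover have "G\<lparr>carrier := \<alpha> ` A\<rparr> \<cong> G\<lparr>carrier := A\<rparr>" if "A \<in> D" for A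
  proof -
    have "subgroup A G"
      by (rule complete_decompositions_subgroup[OF D that])
    then show ?thesis
      using group.iso_sym[OF subgroup_imp_group is_isoI[OF iso_restrict_subgroup[OF \<alpha>]]] by blast
  qed
  ultimately show "isomorphic_decompositions G D E"
    unfolding isomorphic_decompositions_def by blast
qed

section \<open>The action and its orbits\<close>

lemma decomposition_action_group_action:
  assumes "comm_group G"
  shows "group_action (AutoGroup G) (complete_decompositions G) (decomposition_action G)"
proof -
  interpret comm_group G by fact
  let ?S = "complete_decompositions G" and ?act = "decomposition_action G"
  have subset: "A \<subseteq> carrier G" if "D \<in> ?S" "A \<in> D" for D A
    using subgroup.subset[OF complete_decompositions_subgroup[OF that]] .
  have act_closed: "?act \<alpha> D \<in> ?S" if "\<alpha> \<in> carrier (AutoGroup G)" "D \<in> ?S" for \<alpha> D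
    using complete_decompositions_iso_image[OF assms assms] that
    by (auto simp: decomposition_action_def carrier_AutoGroup)
  have act_comp: "?act (compose (carrier G) \<alpha> \<beta>) D = ?act \<alpha> (?act \<beta> D)"
    if "\<beta> \<in> carrier (AutoGroup G)" "D \<in> ?S" for \<alpha> \<beta> D
  proof -
    have "compose (carrier G) \<alpha> \<beta> ` A = \<alpha> ` \<beta> ` A" if "A \<in> D" for A
      using subset[OF \<open>D \<in> ?S\<close> that]
      by (auto simp: compose_def image_image intro!: image_cong)
    then show ?thesis
      using that act_closed[OF that] by (simp add: decomposition_action_def image_image)
  qed
  have act_id: "?act (\<lambda>x\<in>carrier G. x) D = D" if "D \<in> ?S" for D
  proof -
    have "(\<lambda>x\<in>carrier G. x) ` A = A" if "A \<in> D" for A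
      using subset[OF \<open>D \<in> ?S\<close> that] by (auto simp: image_iff subset_iff)
    then show ?thesis
      using that by (simp add: decomposition_action_def)
  qed
  interpret Aut: group "AutoGroup G" by (rule AutoGroup)
  have Aut_mult: "\<alpha> \<otimes>\<^bsub>AutoGroup G\<^esub> \<beta> = compose (carrier G) \<alpha> \<beta>"
    if "\<alpha> \<in> carrier (AutoGroup G)" "\<beta> \<in> carrier (AutoGroup G)" for \<alpha> \<beta>
    using that by (simp add: AutoGroup_def BijGroup_def auto_def)
  have Aut_one: "\<one>\<^bsub>AutoGroup G\<^esub> = (\<lambda>x\<in>carrier G. x)"
    by (simp add: AutoGroup_def BijGroup_def)
  have act_inv: "?act \<alpha> (?act \<beta> D) = D"
    if "\<alpha> \<in> carrier (AutoGroup G)" "\<beta> \<in> carrier (AutoGroup G)"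
      "\<alpha> \<otimes>\<^bsub>AutoGroup G\<^esub> \<beta> = \<one>\<^bsub>AutoGroup G\<^esub>" "D \<in> ?S" for \<alpha> \<beta> D
    using act_comp[OF that(2,4), of \<alpha>] Aut_mult[OF that(1,2)] Aut_one act_id that(3,4) by simp
  have act_Bij: "?act \<alpha> \<in> Bij ?S" if \<alpha>: "\<alpha> \<in> carrier (AutoGroup G)" for \<alpha>
  proof -
    have "bij_betw (?act \<alpha>) ?S ?S"
      by (rule bij_betw_byWitness[where f' = "?act (inv\<^bsub>AutoGroup G\<^esub> \<alpha>)"])
        (use \<alpha> act_closed act_inv in auto)
    then show ?thesis
      by (simp add: Bij_def decomposition_action_def)
  qed
  have "?act (\<alpha> \<otimes>\<^bsub>AutoGroup G\<^esub> \<beta>) = ?act \<alpha> \<otimes>\<^bsub>BijGroup ?S\<^esub> ?act \<beta>"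
    if "\<alpha> \<in> carrier (AutoGroup G)" "\<beta> \<in> carrier (AutoGroup G)" for \<alpha> \<beta>
  proof -
    have "?act (compose (carrier G) \<alpha> \<beta>) = compose ?S (?act \<alpha>) (?act \<beta>)"
      using act_comp[OF that(2)]
      by (intro extensionalityI[where A = ?S])
        (simp_all add: compose_eq, simp_all add: decomposition_action_def)
    then show ?thesis
      using that act_Bij by (simp add: Aut_mult BijGroup_def)
  qed
  then have "?act \<in> hom (AutoGroup G) (BijGroup ?S)"
    using act_Bij by (simp add: hom_def BijGroup_def)
  then show ?thesis
    by (simp add: group_action_def group_hom_def group_hom_axioms_def Aut.is_group group_BijGroup)
qed

lemma orbit_decomposition_action:
  assumes "comm_group G" and D: "D \<in> complete_decompositions G"
  shows "orbit (AutoGroup G) (decomposition_action G) D = decomposition_iso_rel G `` {D}"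
proof -
  interpret group_action "AutoGroup G" "complete_decompositions G" "decomposition_action G"
    by (rule decomposition_action_group_action[OF assms(1)])
  have "E \<in> orbit (AutoGroup G) (decomposition_action G) D \<longleftrightarrow>
      E \<in> complete_decompositions G \<and> isomorphic_decompositions G D E" for E
  proof -
    have "E \<in> orbit (AutoGroup G) (decomposition_action G) D \<Longrightarrow> E \<in> complete_decompositions G"
      using element_image D by (auto simp: orbit_def)
    moreover have "E \<in> orbit (AutoGroup G) (decomposition_action G) D \<longleftrightarrow>
        (\<exists>\<alpha>\<in>carrier (AutoGroup G). (`) \<alpha> ` D = E)"
      using D by (auto simp: orbit_def decomposition_action_def)
    ultimately show ?thesis
      using isomorphic_decompositions_iff_automorphism[OF assms, of E] by blast
  qed
  then show ?thesis
    using D by (auto simp: decomposition_iso_rel_def)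
qed

lemma comm_group_rat_sequences: "comm_group rat_sequences"
proof -
  have "group rational_group"
    by (rule groupI) (auto simp: rational_group_def intro: exI[of _ "- x" for x])
  then have "group rat_sequences"
    by (simp add: rat_sequences_def)
  then show ?thesis
    by (rule group.group_comm_groupI) (simp add: rat_sequences_def rational_group_def add.commute)
qed

theorem theorem4p5:
  fixes G :: "(nat \<Rightarrow> rat) set"
  assumes "subgroup G rat_sequences"
    and "finite_rank (rat_sequences_on G)"
  shows "group_action (AutoGroup (rat_sequences_on G))
           (complete_decompositions (rat_sequences_on G))
           (decomposition_action (rat_sequences_on G)) \<and>
         orbits (AutoGroup (rat_sequences_on G))
           (complete_decompositions (rat_sequences_on G))
           (decomposition_action (rat_sequences_on G)) =
         complete_decompositions (rat_sequences_on G) //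
           decomposition_iso_rel (rat_sequences_on G) \<and>
         (\<forall>D\<in>complete_decompositions (rat_sequences_on G).
           \<forall>E\<in>complete_decompositions (rat_sequences_on G).
            (\<exists>W\<in>orbits (AutoGroup (rat_sequences_on G))
                  (complete_decompositions (rat_sequences_on G))
                  (decomposition_action (rat_sequences_on G)). D \<in> W \<and> E \<in> W)
            \<longleftrightarrow> isomorphic_decompositions (rat_sequences_on G) D E)"
proof -
  let ?G = "rat_sequences_on G"
  let ?Aut = "AutoGroup ?G" and ?S = "complete_decompositions ?G" and ?act = "decomposition_action ?G"
  have comm: "comm_group ?G"
    by (rule comm_group_subgroup[OF comm_group_rat_sequences assms(1)])
  interpret group_action ?Aut ?S ?act
    by (rule decomposition_action_group_action[OF comm])
  have "orbits ?Aut ?S ?act = ?S // decomposition_iso_rel ?G"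
    using orbit_decomposition_action[OF comm] by (auto simp: orbits_def quotient_def)
  moreover have "(\<exists>W\<in>orbits ?Aut ?S ?act. D \<in> W \<and> E \<in> W) \<longleftrightarrow> isomorphic_decompositions ?G D E"
    if D: "D \<in> ?S" and E: "E \<in> ?S" for D E
  proof -
    have "(\<exists>W\<in>orbits ?Aut ?S ?act. D \<in> W \<and> E \<in> W) \<longleftrightarrow> E \<in> orbit ?Aut ?act D"
    proof
      assume "\<exists>W\<in>orbits ?Aut ?S ?act. D \<in> W \<and> E \<in> W"
      then have "\<exists>C\<in>?S. D \<in> orbit ?Aut ?act C \<and> E \<in> orbit ?Aut ?act C"
        by (auto simp: orbits_def)
      then show "E \<in> orbit ?Aut ?act D"
        using orbit_sym orbit_trans D E by blast
    next
      assume "E \<in> orbit ?Aut ?act D"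
      then show "\<exists>W\<in>orbits ?Aut ?S ?act. D \<in> W \<and> E \<in> W"
        using orbit_refl[OF D] D by (auto simp: orbits_def)
    qed
    also have "\<dots> \<longleftrightarrow> isomorphic_decompositions ?G D E"
      using orbit_decomposition_action[OF comm D] D E by (simp add: decomposition_iso_rel_def)
    finally show ?thesis .
  qed
  ultimately show ?thesis
    using group_action_axioms by blast
qed

end
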